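(* Let $H$ be a bipartite graph of order $m$ with a fixed bipartition $(X,Y)$, let $H^\tau$ be an orientation of $H$, and suppose the skew-eigenvalues of $H^\tau$ are the non-zero values $\pm\mu_1 i,\dots,\pm\mu_t i$ together with $m-2t$ zeros. Let $G^\sigma$ be an oriented graph of order $n$ whose skew-eigenvalues are the non-zero values $\pm\lambda_1 i,\dots,\pm\lambda_r i$ together with $n-2r$ zeros. Then the skew-eigenvalues of the oriented graph $(H^\tau\ast G^\sigma)^o$ are: $\pm i\sqrt{(\mu_j^2+1)(\lambda_k^2+1)-1}$, each with multiplicity $2$, for $j=1,\dots,t$, $k=1,\dots,r$; $\pm\mu_j i$, each with multiplicity $n-2r$, for $j=1,\dots,t$; $\pm\lambda_k i$, each with multiplicity $m-2t$, for $k=1,\dots,r$; and $0$ with multiplicity $(m-2t)(n-2r)$.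
   Context: For an oriented graph $D$ on vertices $w_1,\dots,w_N$, its skew-adjacency matrix $S(D)=[s_{ab}]$ has $s_{ab}=1$, $s_{ba}=-1$ if $\langle w_a,w_b\rangle$ is an arc of $D$, and $s_{ab}=s_{ba}=0$ otherwise; the skew-eigenvalues of $D$ are the eigenvalues of $S(D)$ counted with multiplicity. The strong product $H\ast G$ has vertex set $V(H)\times V(G)$, two distinct pairs $(u_1,v_1),(u_2,v_2)$ being adjacent iff $u_1$ is equal or adjacent to $u_2$ and $v_1$ is equal or adjacent to $v_2$; its edge set is the disjoint union of the edge set of the Cartesian product $H\square G$ (pairs with $u_1=u_2$, $v_1v_2\in E(G)$, or $u_1u_2\in E(H)$, $v_1=v_2$) and of the Kronecker product $H\otimes G$ (pairs with $u_1u_2\in E(H)$ and $v_1v_2\in E(G)$). The orientation $(H^\tau\ast G^\sigma)^o$ orients each edge as follows. (i) If $u_1=u_2\in X$: arc from $(u_1,v_1)$ to $(u_2,v_2)$ if $\langle v_1,v_2\rangle$ is an arc of $G^\sigma$, otherwise the reverse arc. (ii) If $u_1=u_2\in Y$: arc from $(u_1,v_1)$ to $(u_2,v_2)$ if $\langle v_2,v_1\rangle$ is an arc of $G^\sigma$, otherwise the reverse arc. (iii) If $v_1=v_2$: arc from $(u_1,v_1)$ to $(u_2,v_2)$ if $\langle u_1,u_2\rangle$ is an arc of $H^\tau$, otherwise the reverse arc. (iv) If $u_1u_2\in E(H)$ and $v_1v_2\in E(G)$, with $u_1\in X$: arc from $(u_1,v_1)$ to $(u_2,v_2)$ if either ($\langle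 u_1,u_2\rangle$ is an arc of $H^\tau$ and $\langle v_1,v_2\rangle$ is an arc of $G^\sigma$) or ($\langle u_2,u_1\rangle$ is an arc of $H^\tau$ and $\langle v_2,v_1\rangle$ is an arc of $G^\sigma$); otherwise the reverse arc. *)

theory Defs
  imports
    Complex_Main
    "HOL-Library.Multiset"
    "HOL-Computational_Algebra.Polynomial"
    "Jordan_Normal_Form.Char_Poly"
    "Graph_Theory.Pair_Digraph"
begin

text \<open>
  A finite simple graph is a \<^locale>\<open>pair_graph\<close>, that is, a finite loopfree symmetric digraph:
  \<open>uv\<close> is an edge iff both \<open>(u, v)\<close> and \<open>(v, u)\<close> are in \<^const>\<open>parcs\<close>.
\<close>

definition orientation_of :: "'a pair_pre_digraph \<Rightarrow> 'a pair_pre_digraph \<Rightarrow> bool" where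
  "orientation_of D G \<longleftrightarrow>
     pverts D = pverts G \<and> parcs D \<union> (parcs D)\<inverse> = parcs G \<and> parcs D \<inter> (parcs D)\<inverse> = {}"

definition bipartition :: "'a pair_pre_digraph \<Rightarrow> 'a set \<Rightarrow> 'a set \<Rightarrow> bool" where
  "bipartition G X Y \<longleftrightarrow>
     X \<union> Y = pverts G \<and> X \<inter> Y = {} \<and>
     (\<forall>(u, v) \<in> parcs G. (u \<in> X \<and> v \<in> Y) \<or> (u \<in> Y \<and> v \<in> X))"

definition vertex_enum :: "'a list \<Rightarrow> 'a pair_pre_digraph \<Rightarrow> bool" where
  "vertex_enum ws D \<longleftrightarrow> distinct ws \<and> set ws = pverts D"

definition skew_adj_mat :: "'a list \<Rightarrow> 'a pair_pre_digraph \<Rightarrow> complex mat" where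
  "skew_adj_mat ws D = mat (length ws) (length ws) (\<lambda>(a, b).
     if (ws ! a, ws ! b) \<in> parcs D then 1
     else if (ws ! b, ws ! a) \<in> parcs D then - 1
     else 0)"

text \<open>
  The multiset of skew-eigenvalues (with algebraic multiplicity). The choice of the vertex
  enumeration is immaterial, see \<open>skew_eigenvalues_eq\<close> below.
\<close>

definition skew_eigenvalues :: "'a pair_pre_digraph \<Rightarrow> complex multiset" where
  "skew_eigenvalues D = proots (char_poly (skew_adj_mat (SOME ws. vertex_enum ws D) D))"

definition strong_product ::
  "'a pair_pre_digraph \<Rightarrow> 'b pair_pre_digraph \<Rightarrow> ('a \<times> 'b) pair_pre_digraph" where
  "strong_product H G =
     \<lparr> pverts = pverts H \<times> pverts G,
       parcs = {((u1, v1), (u2, v2)).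
         u1 \<in> pverts H \<and> u2 \<in> pverts H \<and> v1 \<in> pverts G \<and> v2 \<in> pverts G \<and>
         (u1, v1) \<noteq> (u2, v2) \<and>
         (u1 = u2 \<or> (u1, u2) \<in> parcs H) \<and> (v1 = v2 \<or> (v1, v2) \<in> parcs G)} \<rparr>"

text \<open>
  The arcs of the oriented strong product, where \<open>Ht\<close> and \<open>Gs\<close> are orientations of \<open>H\<close> and \<open>G\<close>.
  Every rule comes in two versions, the second one being the ``otherwise the reverse arc'' clause.
\<close>

inductive_set oriented_strong_arcs ::
  "'a set \<Rightarrow> 'a set \<Rightarrow> 'a pair_pre_digraph \<Rightarrow> 'a pair_pre_digraph \<Rightarrow>
   'b pair_pre_digraph \<Rightarrow> 'b pair_pre_digraph \<Rightarrow> (('a \<times> 'b) \<times> ('a \<times> 'b)) set"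
  for X Y H Ht G Gs where
  X_fwd: "\<lbrakk>u \<in> X; (v1, v2) \<in> parcs G; (v1, v2) \<in> parcs Gs\<rbrakk>
    \<Longrightarrow> ((u, v1), (u, v2)) \<in> oriented_strong_arcs X Y H Ht G Gs"
| X_rev: "\<lbrakk>u \<in> X; (v1, v2) \<in> parcs G; (v1, v2) \<notin> parcs Gs\<rbrakk>
    \<Longrightarrow> ((u, v2), (u, v1)) \<in> oriented_strong_arcs X Y H Ht G Gs"
| Y_fwd: "\<lbrakk>u \<in> Y; (v1, v2) \<in> parcs G; (v2, v1) \<in> parcs Gs\<rbrakk>
    \<Longrightarrow> ((u, v1), (u, v2)) \<in> oriented_strong_arcs X Y H Ht G Gs"
| Y_rev: "\<lbrakk>u \<in> Y; (v1, v2) \<in> parcs G; (v2, v1) \<notin> parcs Gs\<rbrakk>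
    \<Longrightarrow> ((u, v2), (u, v1)) \<in> oriented_strong_arcs X Y H Ht G Gs"
| H_fwd: "\<lbrakk>v \<in> pverts G; (u1, u2) \<in> parcs H; (u1, u2) \<in> parcs Ht\<rbrakk>
    \<Longrightarrow> ((u1, v), (u2, v)) \<in> oriented_strong_arcs X Y H Ht G Gs"
| H_rev: "\<lbrakk>v \<in> pverts G; (u1, u2) \<in> parcs H; (u1, u2) \<notin> parcs Ht\<rbrakk>
    \<Longrightarrow> ((u2, v), (u1, v)) \<in> oriented_strong_arcs X Y H Ht G Gs"
| K_fwd: "\<lbrakk>(u1, u2) \<in> parcs H; (v1, v2) \<in> parcs G; u1 \<in> X;
      ((u1, u2) \<in> parcs Ht \<and> (v1, v2) \<in> parcs Gs) \<or>
      ((u2, u1) \<in> parcs Ht \<and> (v2, v1) \<in> parcs Gs)\<rbrakk>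
    \<Longrightarrow> ((u1, v1), (u2, v2)) \<in> oriented_strong_arcs X Y H Ht G Gs"
| K_rev: "\<lbrakk>(u1, u2) \<in> parcs H; (v1, v2) \<in> parcs G; u1 \<in> X;
      \<not> (((u1, u2) \<in> parcs Ht \<and> (v1, v2) \<in> parcs Gs) \<or>
         ((u2, u1) \<in> parcs Ht \<and> (v2, v1) \<in> parcs Gs))\<rbrakk>
    \<Longrightarrow> ((u2, v2), (u1, v1)) \<in> oriented_strong_arcs X Y H Ht G Gs"

definition oriented_strong_product ::
  "'a set \<Rightarrow> 'a set \<Rightarrow> 'a pair_pre_digraph \<Rightarrow> 'a pair_pre_digraph \<Rightarrow>
   'b pair_pre_digraph \<Rightarrow> 'b pair_pre_digraph \<Rightarrow> ('a \<times> 'b) pair_pre_digraph" where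
  "oriented_strong_product X Y H Ht G Gs =
     \<lparr> pverts = pverts (strong_product H G), parcs = oriented_strong_arcs X Y H Ht G Gs \<rparr>"

lemma orientation_of_cases:
  assumes "orientation_of D G" "(u, v) \<in> parcs G"
  shows "(u, v) \<in> parcs D \<longleftrightarrow> (v, u) \<notin> parcs D"
  using assms unfolding orientation_of_def by blast

lemma orientation_of_oriented_strong_product:
  assumes H: "pair_graph H" and G: "pair_graph G"
    and bip: "bipartition H X Y"
    and Ht: "orientation_of Ht H" and Gs: "orientation_of Gs G"
  shows "orientation_of (oriented_strong_product X Y H Ht G Gs) (strong_product H G)"
proof -
  interpret H: pair_graph H by fact
  interpret G: pair_graph G by fact
  let ?A = "oriented_strong_arcs X Y H Ht G Gs"
  let ?S = "parcs (strong_product H G)"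
  have XY: "X \<union> Y = pverts H" "X \<inter> Y = {}"
    and e: "\<And>u v. (u, v) \<in> parcs H \<Longrightarrow> (u \<in> X \<and> v \<in> Y) \<or> (u \<in> Y \<and> v \<in> X)"
    using bip unfolding bipartition_def by auto
  have Hs: "(v, u) \<in> parcs H" if "(u, v) \<in> parcs H" for u v
    using that Ht unfolding orientation_of_def by blast
  have Gsy: "(v, u) \<in> parcs G" if "(u, v) \<in> parcs G" for u v
    using that Gs unfolding orientation_of_def by blast
  have Hv: "u \<in> pverts H" "v \<in> pverts H" "u \<noteq> v" if "(u, v) \<in> parcs H" for u v
    using that by (auto dest: H.in_arcsD1 H.in_arcsD2 H.no_loops')
  have Gv: "u \<in> pverts G" "v \<in> pverts G" "u \<noteq> v" if "(u, v) \<in> parcs G" for u v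
    using that by (auto dest: G.in_arcsD1 G.in_arcsD2 G.no_loops')
  have Ho: "(u, v) \<in> parcs Ht \<longleftrightarrow> (v, u) \<notin> parcs Ht" if "(u, v) \<in> parcs H" for u v
    using orientation_of_cases[OF Ht that] .
  have Go: "(u, v) \<in> parcs Gs \<longleftrightarrow> (v, u) \<notin> parcs Gs" if "(u, v) \<in> parcs G" for u v
    using orientation_of_cases[OF Gs that] .
  have A_iff: "((u1, v1), (u2, v2)) \<in> ?A \<longleftrightarrow>
      (u1 = u2 \<and> u1 \<in> X \<and> (v1, v2) \<in> parcs G \<and> (v1, v2) \<in> parcs Gs) \<or>
      (u1 = u2 \<and> u1 \<in> Y \<and> (v1, v2) \<in> parcs G \<and> (v2, v1) \<in> parcs Gs) \<or>
      (v1 = v2 \<and> v1 \<in> pverts G \<and> (u1, u2) \<in> parcs H \<and> (u1, u2) \<in> parcs Ht) \<or>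
      ((u1, u2) \<in> parcs H \<and> (v1, v2) \<in> parcs G \<and>
        (u1 \<in> X \<longleftrightarrow> ((u1, u2) \<in> parcs Ht \<longleftrightarrow> (v1, v2) \<in> parcs Gs)))"
    (is "?L \<longleftrightarrow> ?R") for u1 v1 u2 v2
  proof
    assume ?L
    then show ?R
    proof cases
      case K_fwd then show ?thesis using Ho[of u1 u2] Go[of v1 v2] by auto
    next
      case K_rev
      then have "u2 \<in> X" "u1 \<notin> X" using e XY by blast+
      then show ?thesis using K_rev Ho[of u1 u2] Go[of v1 v2] Hs Gsy by auto
    qed (use Ho Go Hs Gsy in blast)+
  next
    assume R: ?R
    consider "u1 = u2" "u1 \<in> X" "(v1, v2) \<in> parcs G" "(v1, v2) \<in> parcs Gs"
      | "u1 = u2" "u1 \<in> Y" "(v1, v2) \<in> parcs G" "(v2, v1) \<in> parcs Gs"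
      | "v1 = v2" "v1 \<in> pverts G" "(u1, u2) \<in> parcs H" "(u1, u2) \<in> parcs Ht"
      | "(u1, u2) \<in> parcs H" "(v1, v2) \<in> parcs G" "u1 \<in> X"
        "(u1, u2) \<in> parcs Ht \<longleftrightarrow> (v1, v2) \<in> parcs Gs"
      | "(u1, u2) \<in> parcs H" "(v1, v2) \<in> parcs G" "u1 \<notin> X"
        "\<not> ((u1, u2) \<in> parcs Ht \<longleftrightarrow> (v1, v2) \<in> parcs Gs)"
      using R by blast
    then show ?L
    proof cases
      case 4
      then show ?thesis
        using Ho[of u1 u2] Go[of v1 v2] by (intro oriented_strong_arcs.K_fwd) auto
    next
      case 5
      then have "u2 \<in> X" using e by blast
      then show ?thesis
        using 5 Ho[of u1 u2] Go[of v1 v2] Hs Gsy by (intro oriented_strong_arcs.K_rev) auto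
    qed (auto intro: oriented_strong_arcs.intros)
  qed
  have S_iff: "((u1, v1), (u2, v2)) \<in> ?S \<longleftrightarrow>
      (u1 = u2 \<and> u1 \<in> pverts H \<and> (v1, v2) \<in> parcs G) \<or>
      (v1 = v2 \<and> v1 \<in> pverts G \<and> (u1, u2) \<in> parcs H) \<or>
      ((u1, u2) \<in> parcs H \<and> (v1, v2) \<in> parcs G)" for u1 v1 u2 v2
    using Hv[of u1 u2] Gv[of v1 v2] unfolding strong_product_def by auto
  have un: "(p, q) \<in> ?S \<longleftrightarrow> (p, q) \<in> ?A \<or> (q, p) \<in> ?A" for p q
  proof -
    obtain u1 v1 u2 v2 where p: "p = (u1, v1)" "q = (u2, v2)" by (cases p, cases q) auto
    have X: "u2 \<in> X \<longleftrightarrow> u1 \<notin> X" if "(u1, u2) \<in> parcs H" using e[OF that] XY by blast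
    have X2: "u1 \<in> pverts H \<longleftrightarrow> u1 \<in> X \<or> u1 \<in> Y" using XY by blast
    show ?thesis unfolding p S_iff A_iff
      using X X2 Ho[of u1 u2] Go[of v1 v2] Hs[of u1 u2] Hs[of u2 u1] Gsy[of v1 v2] Gsy[of v2 v1]
      by (smt (verit))
  qed
  have dj: "\<not> ((p, q) \<in> ?A \<and> (q, p) \<in> ?A)" for p q
  proof -
    obtain u1 v1 u2 v2 where p: "p = (u1, v1)" "q = (u2, v2)" by (cases p, cases q) auto
    have X: "u2 \<in> X \<longleftrightarrow> u1 \<notin> X" if "(u1, u2) \<in> parcs H" using e[OF that] XY by blast
    have X2: "\<not> (u1 \<in> X \<and> u1 \<in> Y)" using XY by blast
    show ?thesis unfolding p A_iff
      using X X2 Ho[of u1 u2] Go[of v1 v2] Hs[of u1 u2] Hs[of u2 u1] Gsy[of v1 v2] Gsy[of v2 v1]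
        Hv(3)[of u1 u2] Gv(3)[of v1 v2]
      by (smt (verit))
  qed
  show ?thesis
    unfolding orientation_of_def oriented_strong_product_def using un dj by auto
qed

lemma char_poly_skew_adj_mat_enum:
  assumes ws: "vertex_enum ws D" and ws': "vertex_enum ws' D"
  shows "char_poly (skew_adj_mat ws D) = char_poly (skew_adj_mat ws' D)"
proof -
  define n where "n = length ws"
  have d: "distinct ws" "distinct ws'" and s: "set ws = set ws'"
    using ws ws' unfolding vertex_enum_def by auto
  have n': "length ws' = n"
    using distinct_card[OF d(1)] distinct_card[OF d(2)] s unfolding n_def by simp
  define f where "f i = (THE j. j < n \<and> ws ! j = ws' ! i)" for i
  have ex: "\<exists>!j. j < n \<and> ws ! j = ws' ! i" if "i < n" for i
  proof -
    have "ws' ! i \<in> set ws" using that n' s by (simp add: nth_mem)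
    then obtain j where j: "j < n" "ws ! j = ws' ! i" unfolding n_def in_set_conv_nth by blast
    moreover have "k = j" if "k < n" "ws ! k = ws' ! i" for k
      using nth_eq_iff_index_eq[OF d(1), of k j] that j unfolding n_def by simp
    ultimately show ?thesis by blast
  qed
  have f: "f i < n" "ws ! (f i) = ws' ! i" if "i < n" for i
    using theI'[OF ex[OF that]] unfolding f_def by auto
  have inj: "inj_on f {0..<n}"
  proof (rule inj_onI)
    fix i j assume ij: "i \<in> {0..<n}" "j \<in> {0..<n}" "f i = f j"
    then have "ws' ! i = ws' ! j" using f(2)[of i] f(2)[of j] by simp
    then show "i = j" using ij d(2) n' by (simp add: nth_eq_iff_index_eq)
  qed
  define P :: "complex mat" where "P = mat n n (\<lambda>(i, j). if f i = j then 1 else 0)"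
  define Q :: "complex mat" where "Q = mat n n (\<lambda>(i, j). if i = f j then 1 else 0)"
  let ?A = "skew_adj_mat ws D" and ?B = "skew_adj_mat ws' D"
  have A: "?A \<in> carrier_mat n n" and B: "?B \<in> carrier_mat n n"
    and P: "P \<in> carrier_mat n n" and Q: "Q \<in> carrier_mat n n"
    unfolding skew_adj_mat_def P_def Q_def using n' n_def by auto
  have PQ: "P * Q = 1\<^sub>m n"
  proof (rule eq_matI)
    fix i j assume "i < dim_row (1\<^sub>m n)" "j < dim_col (1\<^sub>m n)"
    then have ij: "i < n" "j < n" by auto
    then have "(P * Q) $$ (i, j) = (\<Sum>k\<in>{0..<n}. P $$ (i, k) * Q $$ (k, j))"
      using P Q by (simp add: scalar_prod_def)
    also have "\<dots> = (\<Sum>k\<in>{0..<n}. if k = f i then (if k = f j then 1 else 0) else 0)"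
      using ij by (intro sum.cong) (auto simp: P_def Q_def)
    also have "\<dots> = 1\<^sub>m n $$ (i, j)"
      using ij f(1)[of i] inj_onD[OF inj, of i j] by (subst sum.delta) auto
    finally show "(P * Q) $$ (i, j) = 1\<^sub>m n $$ (i, j)" .
  qed (auto simp: P_def Q_def)
  have QP: "Q * P = 1\<^sub>m n" using mat_mult_left_right_inverse[OF P Q PQ] .
  have PA: "P * ?A = mat n n (\<lambda>(i, j). ?A $$ (f i, j))"
  proof (rule eq_matI)
    fix i j
    assume "i < dim_row (mat n n (\<lambda>(i, j). ?A $$ (f i, j)))"
      "j < dim_col (mat n n (\<lambda>(i, j). ?A $$ (f i, j)))"
    then have ij: "i < n" "j < n" by auto
    then have "(P * ?A) $$ (i, j) = (\<Sum>k\<in>{0..<n}. P $$ (i, k) * ?A $$ (k, j))"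
      using A P by (simp add: scalar_prod_def)
    also have "\<dots> = (\<Sum>k\<in>{0..<n}. if k = f i then ?A $$ (k, j) else 0)"
      using ij by (intro sum.cong) (auto simp: P_def)
    also have "\<dots> = ?A $$ (f i, j)" using f(1)[OF ij(1)] by simp
    finally show "(P * ?A) $$ (i, j) = mat n n (\<lambda>(i, j). ?A $$ (f i, j)) $$ (i, j)"
      using ij by simp
  qed (use A P in auto)
  have "P * ?A * Q = ?B"
  proof (rule eq_matI)
    fix i j assume "i < dim_row ?B" "j < dim_col ?B"
    then have ij: "i < n" "j < n" using B by auto
    then have "(P * ?A * Q) $$ (i, j) = (\<Sum>k\<in>{0..<n}. (P * ?A) $$ (i, k) * Q $$ (k, j))"
      unfolding PA using Q by (simp add: scalar_prod_def)
    also have "\<dots> = (\<Sum>k\<in>{0..<n}. if k = f j then ?A $$ (f i, k) else 0)"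
      using ij by (intro sum.cong) (auto simp: Q_def PA)
    also have "\<dots> = ?A $$ (f i, f j)" using f(1)[OF ij(2)] by simp
    also have "\<dots> = ?B $$ (i, j)"
      using ij f n' n_def by (simp add: skew_adj_mat_def)
    finally show "(P * ?A * Q) $$ (i, j) = ?B $$ (i, j)" .
  qed (use A B P Q in auto)
  then have "similar_mat_wit ?B ?A P Q"
    using A B P Q PQ QP by (intro similar_mat_witI[of _ _ n]) auto
  then have "similar_mat ?B ?A" unfolding similar_mat_def by blast
  then show ?thesis using char_poly_similar by metis
qed

lemma skew_eigenvalues_eq:
  assumes "vertex_enum ws D"
  shows "skew_eigenvalues D = proots (char_poly (skew_adj_mat ws D))"
proof -
  have "vertex_enum (SOME ws. vertex_enum ws D) D" using assms by (rule someI)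
  from char_poly_skew_adj_mat_enum[OF this assms] show ?thesis
    unfolding skew_eigenvalues_def by simp
qed

end

theory Submission
  imports Defs "Jordan_Normal_Form.Schur_Decomposition"
begin

text \<open>
  Let \<open>A\<close>, \<open>B\<close> be the skew-adjacency matrices of the two factors and \<open>D\<close> the diagonal matrix with
  entry \<open>1\<close> on \<open>X\<close> and \<open>-1\<close> on \<open>Y\<close>. The orientation is chosen such that the product has the
  skew-adjacency matrix \<open>S = D \<otimes> B + A \<otimes> I + DA \<otimes> B\<close>. Since \<open>D\<^sup>2 = I\<close> and \<open>AD = - DA\<close>, all mixed
  terms of \<open>S\<^sup>2\<close> cancel and \<open>I - S\<^sup>2 = (I - A\<^sup>2) \<otimes> (I - B\<^sup>2)\<close>; triangularising both factors gives
  the spectrum of \<open>I - S\<^sup>2\<close> with multiplicities. As \<open>S\<close> is similar to \<open>S\<^sup>T = - S\<close>, its spectrum is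
  symmetric about \<open>0\<close> and hence determined by the squares of its elements.
\<close>

subsection \<open>Spectra of complex matrices\<close>

text \<open>The same algebraic multiplicities as in \<open>skew_eigenvalues\<close>, but for an
  arbitrary matrix and free of any choice of vertex enumeration.\<close>

definition eigs :: "complex mat \<Rightarrow> complex multiset" where
  "eigs A = proots (char_poly A)"

lemma eigs_upper_triangular:
  assumes "A \<in> carrier_mat n n" "upper_triangular A"
  shows "eigs A = mset (diag_mat A)"
proof -
  have "proots (\<Prod>a\<leftarrow>as. [:- a, 1:]) = mset as" for as :: "complex list"
  proof (induction as)
    case (Cons a as)
    have "(\<Prod>a\<leftarrow>as. [:- a, 1:]) \<noteq> 0" by (auto simp: prod_list_zero_iff)
    then have "proots ([:- a, 1:] * (\<Prod>a\<leftarrow>as. [:- a, 1:])) = {#a#} + mset as"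
      using Cons by (subst proots_mult) auto
    then show ?case by simp
  qed simp
  then show ?thesis
    unfolding eigs_def char_poly_upper_triangular[OF assms] .
qed

text \<open>Over the complex numbers the characteristic polynomial splits, so a Schur decomposition
  exists. Similar matrices share their characteristic polynomial, hence the eigenvalues of
  \<open>A\<close> stand on the diagonal of \<open>T\<close>.\<close>

lemma schur_form:
  fixes A :: "complex mat"
  assumes A: "A \<in> carrier_mat n n"
  obtains T P Q where "T \<in> carrier_mat n n" "P \<in> carrier_mat n n" "Q \<in> carrier_mat n n"
    "upper_triangular T" "P * Q = 1\<^sub>m n" "Q * P = 1\<^sub>m n" "A = P * T * Q" "eigs A = mset (diag_mat T)"
proof -
  obtain es where es: "char_poly A = (\<Prod>a\<leftarrow>es. [:- a, 1:])"
    using char_poly_factorized[OF A] by blast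
  obtain T P Q where "schur_decomposition A es = (T, P, Q)"
    by (cases "schur_decomposition A es") auto
  from schur_decomposition[OF A es this]
  have sim: "similar_mat_wit A T P Q" and T: "upper_triangular T" by auto
  note w = similar_mat_witD2[OF A sim]
  have "eigs A = eigs T"
    unfolding eigs_def using sim char_poly_similar[of A T] unfolding similar_mat_def by metis
  then have "eigs A = mset (diag_mat T)"
    using eigs_upper_triangular[OF _ T] w by auto
  then show thesis using that[of T P Q] w T by auto
qed

lemma eigs_conj:
  assumes "T \<in> carrier_mat n n" "P \<in> carrier_mat n n" "Q \<in> carrier_mat n n"
    "P * Q = 1\<^sub>m n" "Q * P = 1\<^sub>m n"
  shows "eigs (P * T * Q) = eigs T"
proof -
  have "similar_mat_wit (P * T * Q) T P Q"
    using assms by (intro similar_mat_witI[of _ _ n]) auto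
  then show ?thesis
    unfolding eigs_def using char_poly_similar[of "P * T * Q" T] unfolding similar_mat_def by metis
qed

text \<open>A term of the sum for entry (i, j) can be non-zero only if i \<le> k \<le> j. No such k
  exists below the diagonal, and only k = i on it.\<close>

lemma upper_triangular_mult_diag:
  fixes T U :: "'a :: semiring_0 mat"
  assumes T: "T \<in> carrier_mat n n" "upper_triangular T"
    and U: "U \<in> carrier_mat n n" "upper_triangular U"
  shows "upper_triangular (T * U)" "\<And>i. i < n \<Longrightarrow> (T * U) $$ (i, i) = T $$ (i, i) * U $$ (i, i)"
proof -
  have e: "(T * U) $$ (i, j) = (\<Sum>k\<in>{0..<n}. T $$ (i, k) * U $$ (k, j))" if "i < n" "j < n" for i j
    using that T U by (simp add: scalar_prod_def)
  show "upper_triangular (T * U)"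
  proof (rule upper_triangularI)
    fix i j assume ij: "j < i" "i < dim_row (T * U)"
    then have "i < n" "j < n" using T by auto
    moreover have "T $$ (i, k) * U $$ (k, j) = 0" if "k < n" for k
      using ij T U that upper_triangularD[OF T(2), of k i] upper_triangularD[OF U(2), of j k]
      by (cases "k < i") auto
    ultimately show "(T * U) $$ (i, j) = 0" by (simp add: e)
  qed
  show "(T * U) $$ (i, i) = T $$ (i, i) * U $$ (i, i)" if i: "i < n" for i
  proof -
    have "T $$ (i, k) * U $$ (k, i) = (if k = i then T $$ (i, i) * U $$ (i, i) else 0)"
      if "k < n" for k
      using T U that i upper_triangularD[OF T(2), of k i] upper_triangularD[OF U(2), of i k]
      by (cases k i rule: linorder_cases) auto
    then have "(T * U) $$ (i, i) = (\<Sum>k\<in>{0..<n}. if k = i then T $$ (i, i) * U $$ (i, i) else 0)"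
      unfolding e[OF i i] by (intro sum.cong) auto
    then show ?thesis using i by simp
  qed
qed

text \<open>Spectral mapping for polynomials of degree at most 2: the conjugation that
  triangularises \<open>A\<close> turns the polynomial in \<open>A\<close> into the same polynomial
  in \<open>T\<close>, which is upper triangular with the polynomial evaluated at the eigenvalues on
  its diagonal. Coefficients (1, 0, -1) give the identity minus the square, and (0, -1, 0) give
  negation.\<close>

lemma eigs_quadratic:
  fixes a b c :: complex
  assumes A: "A \<in> carrier_mat n n"
  shows "eigs (a \<cdot>\<^sub>m 1\<^sub>m n + b \<cdot>\<^sub>m A + c \<cdot>\<^sub>m (A * A)) = image_mset (\<lambda>x. a + b * x + c * x\<^sup>2) (eigs A)"
proof -
  obtain T P Q where T: "T \<in> carrier_mat n n" "upper_triangular T"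
    and P: "P \<in> carrier_mat n n" and Q: "Q \<in> carrier_mat n n"
    and PQ: "P * Q = 1\<^sub>m n" "Q * P = 1\<^sub>m n" and AT: "A = P * T * Q"
    and eA: "eigs A = mset (diag_mat T)"
    using schur_form[OF A] .
  define U where "U = a \<cdot>\<^sub>m 1\<^sub>m n + b \<cdot>\<^sub>m T + c \<cdot>\<^sub>m (T * T)"
  have U: "U \<in> carrier_mat n n" using T by (simp add: U_def)
  note TT = upper_triangular_mult_diag[OF T T]
  have "upper_triangular U"
    using T upper_triangularD[OF T(2)] upper_triangularD[OF TT(1)]
    by (intro upper_triangularI) (simp add: U_def)
  then have "eigs U = mset (diag_mat U)" by (rule eigs_upper_triangular[OF U])
  also have "diag_mat U = map (\<lambda>x. a + b * x + c * x\<^sup>2) (diag_mat T)"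
    using T TT(2) by (auto simp: diag_mat_def U_def power2_eq_square intro!: nth_equalityI)
  also have "mset \<dots> = image_mset (\<lambda>x. a + b * x + c * x\<^sup>2) (eigs A)" by (simp add: eA)
  finally have eU: "eigs U = image_mset (\<lambda>x. a + b * x + c * x\<^sup>2) (eigs A)" .
  have AA: "A * A = P * (T * T) * Q"
  proof -
    have "A * A = P * T * (Q * P) * T * Q"
      unfolding AT using T P Q
      by (simp add: assoc_mult_mat[of _ n n _ n _ n])
    also have "\<dots> = P * (T * T) * Q"
      unfolding PQ using T P Q by (simp add: assoc_mult_mat[of _ n n _ n _ n])
    finally show ?thesis .
  qed
  have "P * U * Q = a \<cdot>\<^sub>m (P * Q) + b \<cdot>\<^sub>m (P * T * Q) + c \<cdot>\<^sub>m (P * (T * T) * Q)"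
    unfolding U_def using T P Q
    by (simp add: mult_add_distrib_mat[of _ n n _ n] add_mult_distrib_mat[of _ n n _ _ n]
        mult_smult_distrib[of _ n n _ n] mult_smult_assoc_mat[of _ n n _ n])
  then have "a \<cdot>\<^sub>m 1\<^sub>m n + b \<cdot>\<^sub>m A + c \<cdot>\<^sub>m (A * A) = P * U * Q"
    by (simp add: PQ AA AT[symmetric])
  then show ?thesis using eigs_conj[OF U P Q PQ] eU by simp
qed

subsection \<open>Kronecker products\<close>

text \<open>An index i stands for the pair of its quotient and remainder. This is the order of
  \<open>List.product\<close>, so enumerating the product vertices by
  \<open>List.product hs gs\<close> leads to exactly this matrix, without a permutation.\<close>

definition kron :: "'a :: semiring_0 mat \<Rightarrow> 'a mat \<Rightarrow> 'a mat" where
  "kron A B = mat (dim_row A * dim_row B) (dim_col A * dim_col B) (\<lambda>(i, j).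
     A $$ (i div dim_row B, j div dim_col B) * B $$ (i mod dim_row B, j mod dim_col B))"

lemma kron_carrier [simp]:
  "A \<in> carrier_mat m m \<Longrightarrow> B \<in> carrier_mat n n \<Longrightarrow> kron A B \<in> carrier_mat (m * n) (m * n)"
  by (auto simp: kron_def)

lemma div_less_of_less_mult: "(i::nat) < m * n \<Longrightarrow> i div n < m"
  by (simp add: less_mult_imp_div_less)

lemma mod_less_of_less_mult: "(i::nat) < m * n \<Longrightarrow> i mod n < n"
  by (cases "n = 0") auto

lemma kron_index:
  "A \<in> carrier_mat m m \<Longrightarrow> B \<in> carrier_mat n n \<Longrightarrow> i < m * n \<Longrightarrow> j < m * n \<Longrightarrow>
    kron A B $$ (i, j) = A $$ (i div n, j div n) * B $$ (i mod n, j mod n)"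
  by (auto simp: kron_def)

text \<open>Division with remainder by n is a bijection from the indices below m * n onto the pairs,
  with inverse sending (i, j) to i * n + j.\<close>

lemma sum_div_mod:
  fixes f :: "nat \<Rightarrow> nat \<Rightarrow> 'a :: comm_monoid_add"
  shows "(\<Sum>k\<in>{0..<m * n}. f (k div n) (k mod n)) = (\<Sum>i\<in>{0..<m}. \<Sum>j\<in>{0..<n}. f i j)"
proof -
  have "(\<Sum>k\<in>{0..<m * n}. f (k div n) (k mod n)) = (\<Sum>(i, j)\<in>{0..<m} \<times> {0..<n}. f i j)"
  proof (rule sum.reindex_bij_witness[where i = "\<lambda>(i, j). i * n + j" and j = "\<lambda>k. (k div n, k mod n)"])
    fix p assume p: "p \<in> {0..<m} \<times> {0..<n}"
    then obtain i j where ij: "p = (i, j)" "i < m" "j < n" by auto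
    then have "i * n + j < (i + 1) * n" by simp
    also have "\<dots> \<le> m * n" using ij by (intro mult_right_mono) auto
    finally show "(case p of (i, j) \<Rightarrow> i * n + j) \<in> {0..<m * n}" using ij by simp
  qed (auto simp: div_less_of_less_mult mod_less_of_less_mult)
  then show ?thesis by (simp add: sum.cartesian_product)
qed

text \<open>The mixed-product rule: splitting the summation index into quotient and remainder makes
  the sum factor into an entry of \<open>A * C\<close> and an entry of \<open>B * D\<close>.
  Commutativity of the entries allows the regrouping.\<close>

lemma kron_mult:
  fixes A B C D :: "'a :: comm_semiring_0 mat"
  assumes A: "A \<in> carrier_mat m m" and B: "B \<in> carrier_mat n n"
    and C: "C \<in> carrier_mat m m" and D: "D \<in> carrier_mat n n"
  shows "kron A B * kron C D = kron (A * C) (B * D)"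
proof (rule eq_matI)
  fix i j assume "i < dim_row (kron (A * C) (B * D))" "j < dim_col (kron (A * C) (B * D))"
  then have i: "i < m * n" and j: "j < m * n" using A B C D by (auto simp: kron_def)
  note d = div_less_of_less_mult[OF i] div_less_of_less_mult[OF j]
    mod_less_of_less_mult[OF i] mod_less_of_less_mult[OF j]
  have "(kron A B * kron C D) $$ (i, j) =
      (\<Sum>k\<in>{0..<m * n}. kron A B $$ (i, k) * kron C D $$ (k, j))"
    using i j kron_carrier[OF A B] kron_carrier[OF C D] by (simp add: scalar_prod_def)
  also have "\<dots> = (\<Sum>k\<in>{0..<m * n}. (A $$ (i div n, k div n) * C $$ (k div n, j div n)) *
      (B $$ (i mod n, k mod n) * D $$ (k mod n, j mod n)))"
    using i j by (intro sum.cong refl)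
      (simp add: kron_index[OF A B] kron_index[OF C D] mult.assoc mult.left_commute)
  also have "\<dots> = (\<Sum>p\<in>{0..<m}. \<Sum>q\<in>{0..<n}. (A $$ (i div n, p) * C $$ (p, j div n)) *
      (B $$ (i mod n, q) * D $$ (q, j mod n)))"
    by (rule sum_div_mod)
  also have "\<dots> = (A * C) $$ (i div n, j div n) * (B * D) $$ (i mod n, j mod n)"
    using d A B C D by (simp add: scalar_prod_def sum_product)
  also have "\<dots> = kron (A * C) (B * D) $$ (i, j)"
    using i j A B C D by (subst kron_index[of _ m _ n]) auto
  finally show "(kron A B * kron C D) $$ (i, j) = kron (A * C) (B * D) $$ (i, j)" .
qed (use A B C D in \<open>auto simp: kron_def\<close>)

lemma kron_one: "kron (1\<^sub>m m) (1\<^sub>m n) = (1\<^sub>m (m * n) :: 'a :: semiring_1 mat)"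
proof (rule eq_matI)
  fix i j assume "i < dim_row (1\<^sub>m (m * n) :: 'a mat)" "j < dim_col (1\<^sub>m (m * n) :: 'a mat)"
  then have i: "i < m * n" and j: "j < m * n" by auto
  have "i = j \<longleftrightarrow> i div n = j div n \<and> i mod n = j mod n"
    by (metis div_mult_mod_eq)
  then show "kron (1\<^sub>m m) (1\<^sub>m n) $$ (i, j) = (1\<^sub>m (m * n) :: 'a mat) $$ (i, j)"
    using i j div_less_of_less_mult[OF i] div_less_of_less_mult[OF j]
      mod_less_of_less_mult[OF i] mod_less_of_less_mult[OF j]
    by (simp add: kron_index[of _ m _ n])
qed (auto simp: kron_def)

text \<open>If j < i, then either the quotient of j is smaller, or the quotients agree and the
  remainder is smaller. In the first case the factor from \<open>A\<close> vanishes, in the second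
  the factor from \<open>B\<close>.\<close>

lemma upper_triangular_kron:
  assumes A: "A \<in> carrier_mat m m" "upper_triangular A"
    and B: "B \<in> carrier_mat n n" "upper_triangular B"
  shows "upper_triangular (kron A B)"
proof (rule upper_triangularI)
  fix i j assume ij: "j < i" "i < dim_row (kron A B)"
  then have i: "i < m * n" and j: "j < m * n" using A B by (auto simp: kron_def)
  have "j div n < i div n \<or> j div n = i div n \<and> j mod n < i mod n"
  proof (cases "j div n = i div n")
    case True
    then show ?thesis
      using ij div_mult_mod_eq[of i n] div_mult_mod_eq[of j n] by (metis add_less_cancel_left)
  next
    case False
    then show ?thesis using ij div_le_mono[of j i n] by simp
  qed
  then show "kron A B $$ (i, j) = 0"
    using A B i j div_less_of_less_mult[OF i] mod_less_of_less_mult[OF i]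
      upper_triangularD[OF A(2), of "j div n" "i div n"]
      upper_triangularD[OF B(2), of "j mod n" "i mod n"]
    by (auto simp: kron_index[OF A(1) B(1)])
qed

lemma diag_mat_kron:
  assumes A: "A \<in> carrier_mat m m" and B: "B \<in> carrier_mat n n"
  shows "diag_mat (kron A B) = map (\<lambda>(a, b). a * b) (List.product (diag_mat A) (diag_mat B))"
proof (rule nth_equalityI)
  show "length (diag_mat (kron A B)) =
      length (map (\<lambda>(a, b). a * b) (List.product (diag_mat A) (diag_mat B)))"
    using A B by (simp add: diag_mat_def kron_def)
  fix i assume "i < length (diag_mat (kron A B))"
  then have i: "i < m * n" using A B by (simp add: diag_mat_def kron_def)
  then show "diag_mat (kron A B) ! i =
      map (\<lambda>(a, b). a * b) (List.product (diag_mat A) (diag_mat B)) ! i"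
    using A B div_less_of_less_mult[OF i] mod_less_of_less_mult[OF i]
    by (simp add: diag_mat_def product_nth kron_index[OF A B] carrier_matD(1)[OF kron_carrier[OF A B]])
qed

lemma mset_map_product:
  "mset (map (\<lambda>(a, b). f a b) (List.product xs ys)) =
    (\<Sum>a\<in>#mset xs. image_mset (f a) (mset ys))"
  by (induction xs) (auto simp: comp_def)

text \<open>By the mixed-product rule the Schur forms of the factors combine:
  \<open>kron P P'\<close> is invertible with inverse \<open>kron Q Q'\<close> and conjugates the
  triangular \<open>kron T T'\<close> to \<open>kron A B\<close>. The diagonal of
  \<open>kron T T'\<close> lists all products of eigenvalues.\<close>

lemma eigs_kron:
  assumes A: "A \<in> carrier_mat m m" and B: "B \<in> carrier_mat n n"
  shows "eigs (kron A B) = (\<Sum>a\<in>#eigs A. image_mset ((*) a) (eigs B))"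
proof -
  obtain T P Q where T: "T \<in> carrier_mat m m" "upper_triangular T"
    and P: "P \<in> carrier_mat m m" and Q: "Q \<in> carrier_mat m m"
    and PQ: "P * Q = 1\<^sub>m m" "Q * P = 1\<^sub>m m" and AT: "A = P * T * Q"
    and eA: "eigs A = mset (diag_mat T)"
    using schur_form[OF A] .
  obtain T' P' Q' where T': "T' \<in> carrier_mat n n" "upper_triangular T'"
    and P': "P' \<in> carrier_mat n n" and Q': "Q' \<in> carrier_mat n n"
    and PQ': "P' * Q' = 1\<^sub>m n" "Q' * P' = 1\<^sub>m n" and BT: "B = P' * T' * Q'"
    and eB: "eigs B = mset (diag_mat T')"
    using schur_form[OF B] .
  have "kron A B = kron P P' * kron T T' * kron Q Q'"
    using T P Q T' P' Q' by (simp add: AT BT kron_mult[of _ m _ n])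
  moreover have "kron P P' * kron Q Q' = 1\<^sub>m (m * n)" "kron Q Q' * kron P P' = 1\<^sub>m (m * n)"
    using P Q P' Q' PQ PQ' by (simp_all add: kron_mult[of _ m _ n] kron_one)
  ultimately have "eigs (kron A B) = eigs (kron T T')"
    using T P Q T' P' Q' by (simp add: eigs_conj[of _ "m * n"])
  also have "\<dots> = mset (diag_mat (kron T T'))"
    using T T' by (intro eigs_upper_triangular[of _ "m * n"] upper_triangular_kron) auto
  also have "\<dots> = (\<Sum>a\<in>#eigs A. image_mset ((*) a) (eigs B))"
    by (simp only: diag_mat_kron[OF T(1) T'(1)] mset_map_product eA eB)
  finally show ?thesis .
qed


subsection \<open>The skew-adjacency matrix of the strong product\<close>

text \<open>Of the nine terms of the square, the six mixed ones cancel in pairs. The remaining ones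
  are \<open>kron (1\<^sub>m m) (B * B)\<close>, \<open>kron (A * A) (1\<^sub>m n)\<close> and
  \<open>kron (- (A * A)) (B * B)\<close>; the sign of the last comes from anticommutation and is
  what makes the result factor.\<close>

lemma one_minus_square_anticommuting:
  fixes D A B :: "'a :: comm_ring_1 mat"
  assumes D: "D \<in> carrier_mat m m" and A: "A \<in> carrier_mat m m" and B: "B \<in> carrier_mat n n"
    and DD: "D * D = 1\<^sub>m m" and AD: "A * D = - (D * A)"
  defines "S \<equiv> kron D B + kron A (1\<^sub>m n) + kron (D * A) B"
  shows "1\<^sub>m (m * n) - S * S = kron (1\<^sub>m m - A * A) (1\<^sub>m n - B * B)"
proof -
  have DA: "D * A \<in> carrier_mat m m" using D A by simp
  \<comment> \<open>The first factors occurring in the square are normalised so that at most one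
    \<open>D\<close> is left, standing in front.\<close>
  have h1: "D * (D * A) = A"
    using D A assoc_mult_mat[OF D D A] DD by simp
  have h2: "A * (D * A) = - (D * A * A)"
    using assoc_mult_mat[OF A D A] AD uminus_mult_left_mat[of "D * A" A] D A by simp
  have h3: "D * A * D = - A"
    using assoc_mult_mat[OF D A D] AD uminus_mult_right_mat[of D "D * A"] D A h1 by simp
  have h4: "D * A * (D * A) = - (A * A)"
    using assoc_mult_mat[OF DA D A] h3 uminus_mult_left_mat[of A A] A by simp
  let ?a = "kron D B" and ?b = "kron A (1\<^sub>m n)" and ?c = "kron (D * A) B"
  have c: "?a \<in> carrier_mat (m * n) (m * n)" "?b \<in> carrier_mat (m * n) (m * n)"
    "?c \<in> carrier_mat (m * n) (m * n)"
    using D A B DA by auto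
  have "S * S = ?a * ?a + ?b * ?a + ?c * ?a + (?a * ?b + ?b * ?b + ?c * ?b) +
      (?a * ?c + ?b * ?c + ?c * ?c)"
    unfolding S_def using c
    by (simp add: mult_add_distrib_mat[of _ "m * n" "m * n" _ "m * n"]
        add_mult_distrib_mat[of _ "m * n" "m * n" _ _ "m * n"] assoc_add_mat[of _ "m * n" "m * n"])
  also have "\<dots> = kron (1\<^sub>m m) (B * B) + kron (- (D * A)) B + kron (- A) (B * B) +
      (kron (D * A) B + kron (A * A) (1\<^sub>m n) + kron (D * A * A) B) +
      (kron A (B * B) + kron (- (D * A * A)) B + kron (- (A * A)) (B * B))"
    using D A B DA by (simp add: kron_mult[of _ m _ n] DD AD h1 h2 h3 h4)
  finally have SS: "S * S = \<dots>" .
  show ?thesis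
  proof (rule eq_matI)
    fix i j
    assume "i < dim_row (kron (1\<^sub>m m - A * A) (1\<^sub>m n - B * B))"
      "j < dim_col (kron (1\<^sub>m m - A * A) (1\<^sub>m n - B * B))"
    then have i: "i < m * n" and j: "j < m * n" using A B by (auto simp: kron_def)
    note d = div_less_of_less_mult[OF i] div_less_of_less_mult[OF j]
      mod_less_of_less_mult[OF i] mod_less_of_less_mult[OF j]
    have k: "kron M N $$ (i, j) = M $$ (i div n, j div n) * N $$ (i mod n, j mod n)"
      "dim_row (kron M N) = m * n" "dim_col (kron M N) = m * n"
      if "M \<in> carrier_mat m m" "N \<in> carrier_mat n n" for M N :: "'a mat"
      using kron_index[OF that i j] kron_carrier[OF that] by auto
    have one: "1\<^sub>m (m * n) $$ (i, j) =
        (1\<^sub>m m $$ (i div n, j div n) * 1\<^sub>m n $$ (i mod n, j mod n) :: 'a)"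
      using k(1)[of "1\<^sub>m m" "1\<^sub>m n"] by (simp add: kron_one)
    \<comment> \<open>With these products kept opaque, the claim at (i, j) is a commutative ring
      identity in matrix entries; \<open>one\<close> splits the entry of the large identity matrix
      accordingly.\<close>
    define AA BB DAA where "AA = A * A" and "BB = B * B" and "DAA = D * A * A"
    have c': "AA \<in> carrier_mat m m" "BB \<in> carrier_mat n n" "DAA \<in> carrier_mat m m"
      using D A B by (auto simp: AA_def BB_def DAA_def)
    show "(1\<^sub>m (m * n) - S * S) $$ (i, j) = kron (1\<^sub>m m - A * A) (1\<^sub>m n - B * B) $$ (i, j)"
      unfolding SS AA_def[symmetric] BB_def[symmetric] DAA_def[symmetric]
      using D A B DA c' i j d 
      by (simp add: k one minus_carrier_mat del: index_one_mat(1) index_mult_mat(1))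
        (simp add: algebra_simps)
  qed (use D A B in \<open>auto simp: S_def kron_def\<close>)
qed

section \<open>Arc signs and the entries of the product's matrix\<close>

definition arc_sign :: "'a pair_pre_digraph \<Rightarrow> 'a \<Rightarrow> 'a \<Rightarrow> complex" where
  "arc_sign D u v = (if (u, v) \<in> parcs D then 1 else if (v, u) \<in> parcs D then - 1 else 0)"

lemma skew_adj_mat_carrier: "skew_adj_mat ws D \<in> carrier_mat (length ws) (length ws)"
  by (simp add: skew_adj_mat_def)

lemma skew_adj_mat_index:
  "a < length ws \<Longrightarrow> b < length ws \<Longrightarrow> skew_adj_mat ws D $$ (a, b) = arc_sign D (ws ! a) (ws ! b)"
  by (simp add: skew_adj_mat_def arc_sign_def)

lemma arc_sign_swap:
  assumes "orientation_of D G"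
  shows "arc_sign D v u = - arc_sign D u v"
  using assms by (auto simp: arc_sign_def orientation_of_def)

lemma eigs_skew_adj_mat_uminus:
  assumes "orientation_of D G"
  shows "image_mset uminus (eigs (skew_adj_mat ws D)) = eigs (skew_adj_mat ws D)"
proof -
  let ?n = "length ws" and ?S = "skew_adj_mat ws D"
  note S = skew_adj_mat_carrier[of ws D]
  \<comment> \<open>Negation is written as a quadratic polynomial so that
    \<open>eigs_quadratic\<close> applies. A matrix and its transpose have the same characteristic
    polynomial, which closes the argument.\<close>
  have "0 \<cdot>\<^sub>m 1\<^sub>m ?n + (- 1) \<cdot>\<^sub>m ?S + 0 \<cdot>\<^sub>m (?S * ?S) = transpose_mat ?S"
  proof (rule eq_matI)
    fix i j assume "i < dim_row (transpose_mat ?S)" "j < dim_col (transpose_mat ?S)"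
    then show "(0 \<cdot>\<^sub>m 1\<^sub>m ?n + (- 1) \<cdot>\<^sub>m ?S + 0 \<cdot>\<^sub>m (?S * ?S)) $$ (i, j) = transpose_mat ?S $$ (i, j)"
      using S arc_sign_swap[OF assms, of "ws ! j" "ws ! i"]
      by (simp add: skew_adj_mat_index del: index_mult_mat(1))
  qed (use S in auto)
  then have "eigs (transpose_mat ?S) = image_mset uminus (eigs ?S)"
    using eigs_quadratic[OF S, of 0 "- 1" 0] by simp
  then show ?thesis using S by (simp add: eigs_def)
qed

text \<open>Every edge of a factor is directed in exactly one way, so each reversing rule yields the
  arcs of a forward rule read from the other end. For edges moving in both coordinates, the end in
  \<open>Y\<close> sees the condition with the orientation of \<open>G\<close> reversed.\<close>

lemma oriented_strong_arcs_iff: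
  assumes bip: "bipartition H X Y" and Ht: "orientation_of Ht H" and Gs: "orientation_of Gs G"
  shows "((u1, v1), (u2, v2)) \<in> oriented_strong_arcs X Y H Ht G Gs \<longleftrightarrow>
      (u1 = u2 \<and> u1 \<in> X \<and> (v1, v2) \<in> parcs Gs) \<or>
      (u1 = u2 \<and> u1 \<in> Y \<and> (v2, v1) \<in> parcs Gs) \<or>
      (v1 = v2 \<and> v1 \<in> pverts G \<and> (u1, u2) \<in> parcs Ht) \<or>
      (u1 \<in> X \<and> ((u1, u2) \<in> parcs Ht \<and> (v1, v2) \<in> parcs Gs \<or>
        (u2, u1) \<in> parcs Ht \<and> (v2, v1) \<in> parcs Gs)) \<or>
      (u1 \<in> Y \<and> ((u1, u2) \<in> parcs Ht \<and> (v2, v1) \<in> parcs Gs \<or>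
        (u2, u1) \<in> parcs Ht \<and> (v1, v2) \<in> parcs Gs))"
    (is "?L \<longleftrightarrow> ?R")
proof -
  have e: "(u \<in> X \<and> v \<in> Y) \<or> (u \<in> Y \<and> v \<in> X)" if "(u, v) \<in> parcs H" for u v
    using bip that unfolding bipartition_def by auto
  have XY: "u \<notin> Y" if "u \<in> X" for u using bip that unfolding bipartition_def by auto
  have Ho: "(u, v) \<in> parcs H \<longleftrightarrow> (u, v) \<in> parcs Ht \<or> (v, u) \<in> parcs Ht"
    "(u, v) \<in> parcs Ht \<Longrightarrow> (v, u) \<notin> parcs Ht" for u v
    using Ht unfolding orientation_of_def by blast+
  have Go: "(u, v) \<in> parcs G \<longleftrightarrow> (u, v) \<in> parcs Gs \<or> (v, u) \<in> parcs Gs"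
    "(u, v) \<in> parcs Gs \<Longrightarrow> (v, u) \<notin> parcs Gs" for u v
    using Gs unfolding orientation_of_def by blast+
  show ?thesis
  proof
    assume ?L
    then show ?R
    proof cases
      case K_rev
      then have "u1 \<in> Y" using e XY by blast
      then show ?thesis using K_rev Ho Go by blast
    qed (use Ho Go in blast)+
  next
    assume ?R
    then consider "u1 = u2" "u1 \<in> X" "(v1, v2) \<in> parcs Gs"
      | "u1 = u2" "u1 \<in> Y" "(v2, v1) \<in> parcs Gs"
      | "v1 = v2" "v1 \<in> pverts G" "(u1, u2) \<in> parcs Ht"
      | "u1 \<in> X" "(u1, u2) \<in> parcs Ht \<and> (v1, v2) \<in> parcs Gs \<or>
          (u2, u1) \<in> parcs Ht \<and> (v2, v1) \<in> parcs Gs"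
      | "u1 \<in> Y" "(u1, u2) \<in> parcs Ht \<and> (v2, v1) \<in> parcs Gs \<or>
          (u2, u1) \<in> parcs Ht \<and> (v1, v2) \<in> parcs Gs"
      by blast
    then show ?L
    proof cases
      case 4
      then show ?thesis using Ho Go by (intro oriented_strong_arcs.K_fwd) blast+
    next
      \<comment> \<open>Such an arc leaves a vertex over \<open>Y\<close>, so it stems from the
        reversing rule, whose end over \<open>X\<close> is here \<open>u2\<close>.\<close>
      case 5
      then have "(u2, u1) \<in> parcs H" using Ho by blast
      then have "u2 \<in> X" using e 5(1) XY by blast
      then show ?thesis using 5 Ho Go by (intro oriented_strong_arcs.K_rev) blast+
    qed (use Ho Go in \<open>auto intro: oriented_strong_arcs.intros\<close>)
  qed
qed

text \<open>The decomposition of the product's matrix read entry by entry, with \<epsilon> the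
  diagonal entry of \<open>D\<close> at \<open>u1\<close>. The summands belong to edges moving in
  \<open>G\<close> only, in \<open>H\<close> only, and in both; since there are no loops, at most
  one is non-zero.\<close>

lemma arc_sign_oriented_strong_product:
  assumes bip: "bipartition H X Y" and Ht: "orientation_of Ht H" and Gs: "orientation_of Gs G"
    and u: "u1 \<in> pverts H" and v: "v1 \<in> pverts G"
  defines "\<epsilon> \<equiv> if u1 \<in> X then 1 else - 1"
  shows "arc_sign (oriented_strong_product X Y H Ht G Gs) (u1, v1) (u2, v2) =
      (if u1 = u2 then \<epsilon> else 0) * arc_sign Gs v1 v2 +
      arc_sign Ht u1 u2 * (if v1 = v2 then 1 else 0) +
      \<epsilon> * arc_sign Ht u1 u2 * arc_sign Gs v1 v2"
proof -
  have e: "(u \<in> X \<and> v \<in> Y) \<or> (u \<in> Y \<and> v \<in> X)" if "(u, v) \<in> parcs Ht" for u v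
    using bip Ht that unfolding bipartition_def orientation_of_def by blast
  have Y: "w \<in> Y \<longleftrightarrow> w \<notin> X" if "w \<in> pverts H" for w
    using bip that unfolding bipartition_def by auto
  have Ho: "(u, v) \<in> parcs Ht \<Longrightarrow> (v, u) \<notin> parcs Ht" for u v
    using Ht unfolding orientation_of_def by blast
  have Go: "(u, v) \<in> parcs Gs \<Longrightarrow> (v, u) \<notin> parcs Gs" for u v
    using Gs unfolding orientation_of_def by blast
  have XY: "w \<notin> Y" if "w \<in> X" for w using bip that unfolding bipartition_def by auto
  note i = oriented_strong_arcs_iff[OF bip Ht Gs]
  show ?thesis
  proof (cases "u1 = u2")
    case True
    have "(u1, u1) \<notin> parcs Ht" using Ho by blast
    then show ?thesis
      unfolding arc_sign_def oriented_strong_product_def pair_pre_digraph.simps i \<epsilon>_def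
      using True Y[OF u] Go[of v1 v2] by simp
  next
    case False
    show ?thesis
    proof (cases "v1 = v2")
      case True
      have "(v1, v1) \<notin> parcs Gs" using Go by blast
      then show ?thesis
        unfolding arc_sign_def oriented_strong_product_def pair_pre_digraph.simps i \<epsilon>_def
        using True False v by simp
    next
      case neq: False
      \<comment> \<open>Once the direction of the edge in \<open>H\<close> and the side of
        \<open>u1\<close> are fixed, both sides become plus or minus the sign of the pair
        \<open>v1\<close>, \<open>v2\<close>; without an edge in \<open>H\<close> both are
        0.\<close>
      consider "(u1, u2) \<in> parcs Ht" "(u2, u1) \<notin> parcs Ht" "u1 \<in> X" "u2 \<in> Y" "u2 \<notin> X"
        | "(u1, u2) \<in> parcs Ht" "(u2, u1) \<notin> parcs Ht" "u1 \<notin> X" "u2 \<in> X" "u2 \<notin> Y"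
        | "(u2, u1) \<in> parcs Ht" "(u1, u2) \<notin> parcs Ht" "u1 \<in> X" "u2 \<in> Y" "u2 \<notin> X"
        | "(u2, u1) \<in> parcs Ht" "(u1, u2) \<notin> parcs Ht" "u1 \<notin> X" "u2 \<in> X" "u2 \<notin> Y"
        | "(u1, u2) \<notin> parcs Ht" "(u2, u1) \<notin> parcs Ht"
        using e Ho XY by metis
      then show ?thesis
        unfolding arc_sign_def oriented_strong_product_def pair_pre_digraph.simps i \<epsilon>_def
        using False neq Y[OF u] Go[of v1 v2] by cases simp_all
    qed
  qed
qed

text \<open>The Kronecker factorisation of the identity minus the square, stated for spectra. It
  determines the eigenvalues of the product only up to sign.\<close>

lemma eigs_oriented_strong_product:
  assumes bip: "bipartition H X Y" and Ht: "orientation_of Ht H" and Gs: "orientation_of Gs G"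
    and hs: "vertex_enum hs H" and gs: "vertex_enum gs G"
  defines "P \<equiv> oriented_strong_product X Y H Ht G Gs"
  shows "image_mset (\<lambda>x. 1 - x\<^sup>2) (eigs (skew_adj_mat (List.product hs gs) P)) =
      (\<Sum>a\<in>#image_mset (\<lambda>x. 1 - x\<^sup>2) (eigs (skew_adj_mat hs Ht)).
        image_mset ((*) a) (image_mset (\<lambda>x. 1 - x\<^sup>2) (eigs (skew_adj_mat gs Gs))))"
proof -
  define m n where "m = length hs" and "n = length gs"
  define \<epsilon> :: "nat \<Rightarrow> complex" where "\<epsilon> i = (if hs ! i \<in> X then 1 else - 1)" for i
  define D where "D = mat_diag m \<epsilon>"
  define A where "A = skew_adj_mat hs Ht"
  define B where "B = skew_adj_mat gs Gs"
  define S where "S = skew_adj_mat (List.product hs gs) P"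
  have c: "D \<in> carrier_mat m m" "A \<in> carrier_mat m m" "B \<in> carrier_mat n n"
    "S \<in> carrier_mat (m * n) (m * n)"
    using skew_adj_mat_carrier[of hs Ht] skew_adj_mat_carrier[of gs Gs]
      skew_adj_mat_carrier[of "List.product hs gs" P]
    by (auto simp: D_def A_def B_def S_def m_def n_def)
  have A_index: "A $$ (i, j) = arc_sign Ht (hs ! i) (hs ! j)" if "i < m" "j < m" for i j
    using that by (simp add: A_def m_def skew_adj_mat_index)
  have B_index: "B $$ (i, j) = arc_sign Gs (gs ! i) (gs ! j)" if "i < n" "j < n" for i j
    using that by (simp add: B_def n_def skew_adj_mat_index)
  have DA: "D * A = mat m m (\<lambda>(i, j). \<epsilon> i * A $$ (i, j))"
    unfolding D_def by (rule mat_diag_mult_left[OF c(2)])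
  have AD: "A * D = mat m m (\<lambda>(i, j). A $$ (i, j) * \<epsilon> j)"
    unfolding D_def by (rule mat_diag_mult_right[OF c(2)])
  have "D * D = 1\<^sub>m m"
    unfolding D_def mat_diag_diag by (rule eq_matI) (auto simp: \<epsilon>_def mat_diag_def)
  moreover have "A * D = - (D * A)"
  proof (rule eq_matI)
    fix i j assume "i < dim_row (- (D * A))" "j < dim_col (- (D * A))"
    then have ij: "i < m" "j < m" using c by auto
    \<comment> \<open>An arc of \<open>Ht\<close> joins \<open>X\<close> to \<open>Y\<close>, so
      \<epsilon> changes sign along it; where there is no arc, the entry of \<open>A\<close> is 0.
      Both cases give anticommutation.\<close>
    have "hs ! i \<in> X \<longleftrightarrow> hs ! j \<notin> X"
      if "(hs ! i, hs ! j) \<in> parcs Ht \<or> (hs ! j, hs ! i) \<in> parcs Ht"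
    proof -
      have "(hs ! i, hs ! j) \<in> parcs H"
        using that Ht unfolding orientation_of_def by blast
      then show ?thesis using bip unfolding bipartition_def by fastforce
    qed
    then have "A $$ (i, j) = 0 \<or> \<epsilon> j = - \<epsilon> i"
      unfolding A_index[OF ij] arc_sign_def \<epsilon>_def by auto
    then show "(A * D) $$ (i, j) = (- (D * A)) $$ (i, j)"
      unfolding AD DA using ij by auto
  qed (use c in auto)
  moreover have "S = kron D B + kron A (1\<^sub>m n) + kron (D * A) B"
  proof (rule eq_matI)
    fix i j
    assume "i < dim_row (kron D B + kron A (1\<^sub>m n) + kron (D * A) B)"
      "j < dim_col (kron D B + kron A (1\<^sub>m n) + kron (D * A) B)"
    then have i: "i < m * n" and j: "j < m * n" using c by (auto simp: kron_def)
    note d = div_less_of_less_mult[OF i] div_less_of_less_mult[OF j]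
      mod_less_of_less_mult[OF i] mod_less_of_less_mult[OF j]
    have dist: "distinct hs" "distinct gs" and sets: "set hs = pverts H" "set gs = pverts G"
      using hs gs by (auto simp: vertex_enum_def)
    \<comment> \<open>Distinct enumerations turn equality of vertices into equality of indices, as
      in the entries of \<open>D\<close> and of the identity matrix.\<close>
    have eq: "hs ! (i div n) = hs ! (j div n) \<longleftrightarrow> i div n = j div n"
      "gs ! (i mod n) = gs ! (j mod n) \<longleftrightarrow> i mod n = j mod n"
      using d dist by (auto simp: nth_eq_iff_index_eq m_def n_def)
    have v: "hs ! (i div n) \<in> pverts H" "gs ! (i mod n) \<in> pverts G"
      using d sets nth_mem[of "i div n" hs] nth_mem[of "i mod n" gs] by (auto simp: m_def n_def)
    have "S $$ (i, j) = arc_sign P (hs ! (i div n), gs ! (i mod n)) (hs ! (j div n), gs ! (j mod n))"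
      using i j by (simp add: S_def skew_adj_mat_index product_nth m_def n_def)
    also have "\<dots> = (if i div n = j div n then \<epsilon> (i div n) else 0) * B $$ (i mod n, j mod n) +
        A $$ (i div n, j div n) * (if i mod n = j mod n then 1 else 0) +
        \<epsilon> (i div n) * A $$ (i div n, j div n) * B $$ (i mod n, j mod n)"
      unfolding P_def arc_sign_oriented_strong_product[OF bip Ht Gs v] eq \<epsilon>_def
      using d by (simp only: A_index B_index)
    also have "\<dots> = (kron D B + kron A (1\<^sub>m n) + kron (D * A) B) $$ (i, j)"
    proof -
      have cDA: "D * A \<in> carrier_mat m m" using c by simp
      have "D $$ (i div n, j div n) = (if i div n = j div n then \<epsilon> (i div n) else 0)"
        using d by (auto simp: D_def mat_diag_def)
      moreover have "(D * A) $$ (i div n, j div n) = \<epsilon> (i div n) * A $$ (i div n, j div n)"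
        unfolding DA using d by simp
      moreover have "dim_row (kron M N) = m * n" "dim_col (kron M N) = m * n"
        if "M \<in> carrier_mat m m" "N \<in> carrier_mat n n" for M N :: "complex mat"
        using kron_carrier[OF that] by auto
      ultimately show ?thesis
        using i j d c cDA
        by (simp add: kron_index[of _ m _ n] del: index_mult_mat(1))
    qed
    finally show "S $$ (i, j) = (kron D B + kron A (1\<^sub>m n) + kron (D * A) B) $$ (i, j)" .
  qed (use c in \<open>auto simp: kron_def\<close>)
  ultimately have "1\<^sub>m (m * n) - S * S = kron (1\<^sub>m m - A * A) (1\<^sub>m n - B * B)"
    using one_minus_square_anticommuting[OF c(1-3)] by simp
  then have "eigs (1\<^sub>m (m * n) - S * S) =
      (\<Sum>a\<in>#eigs (1\<^sub>m m - A * A). image_mset ((*) a) (eigs (1\<^sub>m n - B * B)))"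
    using c by (simp add: eigs_kron[of _ m _ n] minus_carrier_mat)
  moreover have "eigs (1\<^sub>m k - M * M) = image_mset (\<lambda>x. 1 - x\<^sup>2) (eigs M)"
    if M: "M \<in> carrier_mat k k" for k M
  proof -
    have "1\<^sub>m k - M * M = 1 \<cdot>\<^sub>m 1\<^sub>m k + 0 \<cdot>\<^sub>m M + (- 1) \<cdot>\<^sub>m (M * M)"
      using M by (intro eq_matI) (auto simp del: index_mult_mat(1))
    then show ?thesis using eigs_quadratic[OF M, of 1 0 "- 1"] by simp
  qed
  ultimately show ?thesis
    using c by (simp add: A_def B_def S_def)
qed

subsection \<open>Recovering a symmetric multiset from its squares\<close>

text \<open>The points with the same value of 1 - x^2 as z are z and -z. By symmetry they are
  equally frequent, so the frequency of the value determines that of z.\<close>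

lemma symmetric_mset_eqI:
  fixes E F :: "complex multiset"
  assumes E: "image_mset uminus E = E" and F: "image_mset uminus F = F"
    and EF: "image_mset (\<lambda>x. 1 - x\<^sup>2) E = image_mset (\<lambda>x. 1 - x\<^sup>2) F"
  shows "E = F"
proof (rule multiset_eqI)
  fix z :: complex
  \<comment> \<open>For z = 0 the two preimages coincide and must be counted once.\<close>
  have sq: "count (image_mset (\<lambda>x. 1 - x\<^sup>2) M) (1 - z\<^sup>2) =
      count M z + (if z = 0 then 0 else count M (- z))" for M
    by (induction M) (auto simp: power2_eq_iff)
  have neg: "count M (- z) = count M z" if "image_mset uminus M = M" for M :: "complex multiset"
  proof -
    have "count (image_mset uminus M) (- z) = count M z"
      by (induction M) auto
    then show ?thesis using that by simp
  qed
  show "count E z = count F z"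
    using sq[of E] sq[of F] EF neg[OF E] neg[OF F] by (auto split: if_splits)
qed

section \<open>Multisets made of opposite pairs and zeros\<close>

lemma sum_mset_sum:
  fixes A :: "'a \<Rightarrow> 'b :: comm_monoid_add multiset"
  shows "sum_mset (\<Sum>j\<in>J. A j) = (\<Sum>j\<in>J. sum_mset (A j))"
  by (induction J rule: infinite_finite_induct) auto

lemma image_mset_sum: "image_mset f (\<Sum>j\<in>J. A j) = (\<Sum>j\<in>J. image_mset f (A j))"
  by (induction J rule: infinite_finite_induct) auto

lemma repeat_mset_sum: "repeat_mset k (\<Sum>j\<in>J. A j) = (\<Sum>j\<in>J. repeat_mset k (A j))"
  by (induction J rule: infinite_finite_induct) auto

lemma sum_mset_replicate_mset_multiset: "sum_mset (replicate_mset k M) = repeat_mset k M"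
  by (induction k) auto

lemma repeat_mset_replicate_mset_mult: "repeat_mset k (replicate_mset l x) = replicate_mset (k * l) x"
  by (rule multiset_eqI) simp

text \<open>Distributivity, with multiplicities multiplying. The ones are the images of zero
  eigenvalues under 1 - x^2, and each value of multiplicity 2 is the common image of an opposite
  pair.\<close>

lemma product_paired_mset:
  fixes p :: "'j \<Rightarrow> complex" and q :: "'k \<Rightarrow> complex"
  shows "(\<Sum>x\<in>#(\<Sum>j\<in>J. replicate_mset 2 (p j)) + replicate_mset a 1.
      image_mset ((*) x) ((\<Sum>k\<in>K. replicate_mset 2 (q k)) + replicate_mset b 1)) =
    (\<Sum>j\<in>J. \<Sum>k\<in>K. replicate_mset (2 * 2) (p j * q k)) +
    (\<Sum>j\<in>J. replicate_mset (2 * b) (p j)) + (\<Sum>k\<in>K. replicate_mset (2 * a) (q k)) +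
    replicate_mset (a * b) 1"
  by (simp only: image_mset_union sum_mset.union image_mset_sum sum_mset_sum
      sum_mset_replicate_mset_multiset image_replicate_mset repeat_mset_distrib2 repeat_mset_sum
      repeat_mset_replicate_mset_mult sum.distrib mult_1_left mult_1_right mult.commute[of a 2]
      add.assoc)

lemma one_minus_square_imaginary: "1 - (\<i> * of_real c)\<^sup>2 = complex_of_real (c\<^sup>2 + 1)"
  by (simp add: power_mult_distrib)

lemma image_one_minus_square_imaginary_pairs:
  "image_mset (\<lambda>x. 1 - x\<^sup>2)
      ((\<Sum>j\<in>J. {# \<i> * of_real (f j), - (\<i> * of_real (f j)) #}) + replicate_mset a 0) =
    (\<Sum>j\<in>J. replicate_mset 2 (complex_of_real ((f j)\<^sup>2 + 1))) + replicate_mset a 1"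
proof -
  have "image_mset (\<lambda>x. 1 - x\<^sup>2) {# \<i> * of_real c, - (\<i> * of_real c) #} =
      replicate_mset 2 (complex_of_real (c\<^sup>2 + 1))" for c
    by (simp only: image_mset_add_mset image_mset_empty power2_minus one_minus_square_imaginary)
      (simp add: numeral_2_eq_2)
  then show ?thesis by (simp only: image_mset_union image_mset_sum) simp
qed

section \<open>The spectrum of the oriented strong product from those of its factors\<close>

theorem theorem2p6:
  fixes H Ht :: "'a pair_pre_digraph" and G Gs :: "'b pair_pre_digraph"
    and X Y :: "'a set" and m n t r :: nat and mu lam :: "nat \<Rightarrow> real"
  assumes H: "pair_graph H" "card (pverts H) = m"
    and bip: "bipartition H X Y"
    and Ht: "orientation_of Ht H"
    and mu_nz: "\<And>j. j \<in> {1..t} \<Longrightarrow> mu j \<noteq> 0"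
    and mu_eig: "skew_eigenvalues Ht =
      (\<Sum>j=1..t. {# \<i> * of_real (mu j), - (\<i> * of_real (mu j)) #}) + replicate_mset (m - 2 * t) 0"
    and G: "pair_graph G" "card (pverts G) = n"
    and Gs: "orientation_of Gs G"
    and lam_nz: "\<And>k. k \<in> {1..r} \<Longrightarrow> lam k \<noteq> 0"
    and lam_eig: "skew_eigenvalues Gs =
      (\<Sum>k=1..r. {# \<i> * of_real (lam k), - (\<i> * of_real (lam k)) #}) + replicate_mset (n - 2 * r) 0"
  shows "skew_eigenvalues (oriented_strong_product X Y H Ht G Gs) =
      (\<Sum>j=1..t. \<Sum>k=1..r.
         replicate_mset 2 (\<i> * of_real (sqrt (((mu j)\<^sup>2 + 1) * ((lam k)\<^sup>2 + 1) - 1))) +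
         replicate_mset 2 (- (\<i> * of_real (sqrt (((mu j)\<^sup>2 + 1) * ((lam k)\<^sup>2 + 1) - 1))))) +
      (\<Sum>j=1..t. replicate_mset (n - 2 * r) (\<i> * of_real (mu j)) +
         replicate_mset (n - 2 * r) (- (\<i> * of_real (mu j)))) +
      (\<Sum>k=1..r. replicate_mset (m - 2 * t) (\<i> * of_real (lam k)) +
         replicate_mset (m - 2 * t) (- (\<i> * of_real (lam k)))) +
      replicate_mset ((m - 2 * t) * (n - 2 * r)) 0"
proof -
  define P where "P = oriented_strong_product X Y H Ht G Gs"
  define R where "R = (\<Sum>j=1..t. \<Sum>k=1..r.
         replicate_mset 2 (\<i> * of_real (sqrt (((mu j)\<^sup>2 + 1) * ((lam k)\<^sup>2 + 1) - 1))) +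
         replicate_mset 2 (- (\<i> * of_real (sqrt (((mu j)\<^sup>2 + 1) * ((lam k)\<^sup>2 + 1) - 1))))) +
      (\<Sum>j=1..t. replicate_mset (n - 2 * r) (\<i> * of_real (mu j)) +
         replicate_mset (n - 2 * r) (- (\<i> * of_real (mu j)))) +
      (\<Sum>k=1..r. replicate_mset (m - 2 * t) (\<i> * of_real (lam k)) +
         replicate_mset (m - 2 * t) (- (\<i> * of_real (lam k)))) +
      replicate_mset ((m - 2 * t) * (n - 2 * r)) (0 :: complex)"
  interpret H: pair_graph H by fact
  interpret G: pair_graph G by fact
  obtain hs where hs: "vertex_enum hs H"
    using finite_distinct_list[OF H.finite_verts] by (auto simp: vertex_enum_def)
  obtain gs where gs: "vertex_enum gs G"
    using finite_distinct_list[OF G.finite_verts] by (auto simp: vertex_enum_def)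
  have P: "vertex_enum (List.product hs gs) P"
    using hs gs by (auto simp: vertex_enum_def P_def oriented_strong_product_def
        strong_product_def distinct_product)
  have "vertex_enum hs Ht" "vertex_enum gs Gs"
    using hs gs Ht Gs by (auto simp: vertex_enum_def orientation_of_def)
  then have eH: "eigs (skew_adj_mat hs Ht) = skew_eigenvalues Ht"
    and eG: "eigs (skew_adj_mat gs Gs) = skew_eigenvalues Gs"
    and eP: "eigs (skew_adj_mat (List.product hs gs) P) = skew_eigenvalues P"
    using P by (simp_all add: eigs_def skew_eigenvalues_eq)
  have "image_mset uminus (skew_eigenvalues P) = skew_eigenvalues P"
    unfolding eP[symmetric] unfolding P_def
    by (rule eigs_skew_adj_mat_uminus[OF orientation_of_oriented_strong_product[OF H(1) G(1) bip Ht Gs]])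
  \<comment> \<open>Negation swaps the two members of each opposite pair, which have equal
    multiplicity, and fixes the zeros.\<close>
  moreover have "image_mset uminus R = R"
    unfolding R_def image_mset_union image_mset_sum image_replicate_mset minus_minus
    by (simp only: add.commute[of "replicate_mset _ (- _)"] minus_zero)
  moreover have "image_mset (\<lambda>x. 1 - x\<^sup>2) (skew_eigenvalues P) = image_mset (\<lambda>x. 1 - x\<^sup>2) R"
  proof -
    define p q where "p j = complex_of_real ((mu j)\<^sup>2 + 1)" and "q k = complex_of_real ((lam k)\<^sup>2 + 1)"
      for j k
    have "image_mset (\<lambda>x. 1 - x\<^sup>2) (skew_eigenvalues P) =
        (\<Sum>j=1..t. \<Sum>k=1..r. replicate_mset (2 * 2) (p j * q k)) +
        (\<Sum>j=1..t. replicate_mset (2 * (n - 2 * r)) (p j)) +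
        (\<Sum>k=1..r. replicate_mset (2 * (m - 2 * t)) (q k)) +
        replicate_mset ((m - 2 * t) * (n - 2 * r)) 1"
      using eigs_oriented_strong_product[OF bip Ht Gs hs gs]
      unfolding P_def[symmetric] eP eH eG mu_eig lam_eig image_one_minus_square_imaginary_pairs
        p_def[symmetric] q_def[symmetric] product_paired_mset .
    also have "\<dots> = image_mset (\<lambda>x. 1 - x\<^sup>2) R"
    proof -
      have s: "1 - (\<i> * of_real (sqrt (((mu j)\<^sup>2 + 1) * ((lam k)\<^sup>2 + 1) - 1)))\<^sup>2 = p j * q k" for j k
      proof -
        \<comment> \<open>The radicand is therefore non-negative, so squaring undoes the real square
          root.\<close>
        have "1 * 1 \<le> ((mu j)\<^sup>2 + 1) * ((lam k)\<^sup>2 + 1)" by (intro mult_mono) auto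
        then show ?thesis unfolding one_minus_square_imaginary p_def q_def by simp
      qed
      \<comment> \<open>Both members of an opposite pair have the same image, so every multiplicity
        doubles; the 2 of the square-root eigenvalues becomes the 4 of the product.\<close>
      have two: "replicate_mset c z + replicate_mset c z = replicate_mset (2 * c) z"
        for c and z :: complex
        by (rule multiset_eqI) simp
      show ?thesis
        unfolding R_def image_mset_union image_mset_sum image_replicate_mset power2_minus s two
        unfolding one_minus_square_imaginary p_def[symmetric] q_def[symmetric] by simp
    qed
    finally show ?thesis .
  qed
  ultimately have "skew_eigenvalues P = R" by (rule symmetric_mset_eqI)
  then show ?thesis unfolding P_def R_def .
qed

end
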